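(* Let $\mathfrak{R}:\mathcal{L}_2\rightrightarrows\mathcal{L}_2$ be a reset system with data $(A,B,C,D,R,M)$ as described in the context. Let $\tilde{\mathbf{\Pi}}\subset\mathbf{\Pi}(\mathfrak{R})$ and let $$\mathcal{S}_{\mathrm{SG}}:=\bigcap_{\Pi\in\tilde{\mathbf{\Pi}}}\mathcal{S}(\Pi)$$ be the corresponding over-bound of $\mathrm{SG}(\mathfrak{R})$. Then for any set of inputs $\mathcal{U}\subset\mathcal{L}_2\setminus\{0\}$, with associated set of samples $\mathcal{Z}(\mathfrak{R},\mathcal{U})$, $$\text{h-hull}\big(\mathcal{Z}(\mathfrak{R},\mathcal{U})\big)\subset\mathcal{S}_{\mathrm{SG}}.$$
   Context: Signals: $\mathcal{L}_2$ is the space of functions $u:\mathbb{R}_{\ge0}\to\mathbb{R}^p$ with $\int_0^\infty u^\top(t)u(t)\,dt<\infty$, with inner product $\langle u,y\rangle=\int_0^\infty u^\top(t)y(t)\,dt$ and norm $\|u\|=\sqrt{\langle u,u\rangle}$. Reset system: $\mathfrak{R}$ is given by $\dot x(t)=Ax(t)+Bu(t)$ if $x(t)\in\mathcal{F}$; $x(t^+)=Rx(t)$ if $x(t)\in\mathcal{J}$; $y(t)=Cx(t)+Du(t)$, with state $x(t)\in\mathbb{R}^n$, $x(0)=0$, input $u(t)\in\mathbb{R}^p$, output $y(t)\in\mathbb{R}^p$, $x(t^+)=\lim_{s\downarrow t}x(s)$, real matrices $A,B,C,D,R$ of compatible sizes, $\mathcal{F}=\{\mu\in\mathbb{R}^n\mid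 \mu^\top M\mu\ge0\}$, $\mathcal{J}=\{\mu\in\mathbb{R}^n\mid\mu^\top M\mu<0\}$, and $M$ a real symmetric $n\times n$ matrix. We write $y\in\mathfrak{R}u$ if $y$ is a (possibly non-unique) output of $\mathfrak{R}$ resulting from input $u$. Standing assumption: for inputs $u\in\mathcal{L}_2$ the system exhibits no Zeno behavior (no infinite number of resets in a finite time interval), and $x,y\in\mathcal{L}_2$ and $\lim_{t\to\infty}x(t)=0$. Scaled graph: for $u\in\mathcal{L}_2\setminus\{0\}$ let $z(u,\mathfrak{R})=\{\rho(u,y)e^{\pm j\theta(u,y)}\mid y\in\mathfrak{R}u\}\subset\mathbb{C}$ ($j$ the imaginary unit), where $\rho(u,y)=\|y\|/\|u\|$, $\theta(u,y)=\arccos\big(\langle u,y\rangle/(\|u\|\|y\|)\big)$ if $y\ne0$ and $\theta(u,y)=0$ if $y=0$. Then $\mathrm{SG}(\mathfrak{R})$ is the union of the sets $z(u,\mathfrak{R})$ over $u\in\mathcal{L}_2\setminus\{0\}$. For a set of inputs $\mathcal{U}$, the set of samples $\mathcal{Z}(\mathfrak{R},\mathcal{U})$ is the union of the sets $z(u,\mathfrak{R})$ over $u\in\mathcal{U}$. Quadratic dissipativity: $\mathbb{S}^2$ denotes the real symmetric $2\times2$ matrices. $\mathbf{\Pi}(\mathfrak{R})$ is the set of $\Pi\in\mathbb{S}^2$ such that $\int_0^\infty\begin{bmatrix}y(t)\\ u(t)\end{bmatrix}^\top(\Pi\otimes I_p)\begin{bmatrix}y(t)\\ u(t)\end{bmatrix}dt\ge0$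 for all $u\in\mathcal{L}_2$ and $y\in\mathfrak{R}u$, where $\otimes$ is the Kronecker product. For $\Pi\in\mathbb{S}^2$, $\mathcal{S}(\Pi)=\left\{z\in\mathbb{C}\,\middle|\,\begin{bmatrix}z\\1\end{bmatrix}^*\Pi\begin{bmatrix}z\\1\end{bmatrix}\ge0\right\}$. An intersection over the empty family is $\mathbb{C}$. Hyperbolic convexity: $\mathbb{C}_+$ and $\mathbb{C}_-$ are the complex numbers with non-negative, respectively non-positive, imaginary part, and $\mathrm{conj}(\mathcal{X})=\{\bar x\mid x\in\mathcal{X}\}$. For $z_1,z_2\in\mathbb{C}_+$, $\mathrm{ARC}_{\min}(z_1,z_2)\subset\mathbb{C}_+$ is the geodesic between them under the Poincaré metric: the section in $\mathbb{C}_+$, with endpoints $z_1,z_2$, of the circle centered on the real axis through $z_1,z_2$ (the vertical segment from $z_1$ to $z_2$ if they have equal real parts). A set $\mathcal{C}\subset\mathbb{C}_+$ is h-convex if $z_1,z_2\in\mathcal{C}$ implies $\mathrm{ARC}_{\min}(z_1,z_2)\subset\mathcal{C}$; the h-convex hull $\text{h-hull}(\mathcal{C})$ of $\mathcal{C}\subset\mathbb{C}_+$ is the smallest h-convex set containing $\mathcal{C}$. For a set $\mathcal{C}\subset\mathbb{C}$ symmetric about the real axis (i.e. $\mathcal{C}\cap\mathbb{C}_+=\mathrm{conj}(\mathcal{C}\cap\mathbb{C}_-)$), such as $\mathcal{Z}(\mathfrak{R},\mathcal{U})$, one sets $\text{h-hull}(\mathcal{C}):=\text{h-hull}(\mathcal{C}\cap\mathbb{C}_+)\cup\mathrm{conj}(\text{h-hull}(\mathcal{C}\cap\mathbb{C}_+))$.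 *)

theory Defs
  imports "HOL-Analysis.Analysis"
begin

text \<open>
  Signals are functions on the reals of which only the restriction to \<open>{0..}\<close> matters; equality in
  the space of square-integrable signals is equality almost everywhere on \<open>{0..}\<close>.
\<close>

definition L2 :: "(real \<Rightarrow> real^'k) set" where
  "L2 = {u. u \<in> borel_measurable (lebesgue_on {0..}) \<and>
            integrable (lebesgue_on {0..}) (\<lambda>t. u t \<bullet> u t)}"

definition L2_zero :: "(real \<Rightarrow> real^'k) \<Rightarrow> bool" where
  "L2_zero u \<longleftrightarrow> (AE t in lebesgue_on {0..}. u t = 0)"

definition L2_nonzero :: "(real \<Rightarrow> real^'k) set" where
  "L2_nonzero = {u \<in> L2. \<not> L2_zero u}"

definition L2_inner :: "(real \<Rightarrow> real^'k) \<Rightarrow> (real \<Rightarrow> real^'k) \<Rightarrow> real" where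
  "L2_inner u y = (\<integral>t. u t \<bullet> y t \<partial>lebesgue_on {0..})"

definition L2_norm :: "(real \<Rightarrow> real^'k) \<Rightarrow> real" where
  "L2_norm u = sqrt (L2_inner u u)"


record ('n::finite, 'p::finite) reset_system =
  matA :: "real^'n^'n"
  matB :: "real^'p^'n"
  matC :: "real^'n^'p"
  matD :: "real^'p^'p"
  matR :: "real^'n^'n"
  matM :: "real^'n^'n"

definition flow_set :: "('n::finite, 'p::finite) reset_system \<Rightarrow> (real^'n) set" where
  "flow_set \<RR> = {\<mu>. \<mu> \<bullet> (matM \<RR> *v \<mu>) \<ge> 0}"

definition jump_set :: "('n::finite, 'p::finite) reset_system \<Rightarrow> (real^'n) set" where
  "jump_set \<RR> = {\<mu>. \<mu> \<bullet> (matM \<RR> *v \<mu>) < 0}"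

text \<open>
  \<open>trajectory \<RR> u x T\<close>: \<open>x\<close> is a state trajectory for input \<open>u\<close> with set of reset times \<open>T\<close>.
  The last-but-one conjunct is the differential equation in the sense of Caratheodory (inputs are
  only square-integrable) on intervals \<open>{a..<b}\<close> free of resets; as \<open>b\<close> itself may be a reset time,
  it also makes \<open>x b\<close> the value reached just before the reset.

  A reset is enforced whenever \<open>x t \<in> jump_set \<RR>\<close> (the two sets are complementary) and is allowed
  on the whole of \<open>closure (jump_set \<RR>)\<close>: the jump set is open and \<open>x\<close> is left-continuous, so
  a trajectory that flows in the flow set reaches the jump set through its boundary.  Requiring
  \<open>x t \<in> jump_set \<RR>\<close> at reset times would exclude resets altogether, as there would be no first
  time at which \<open>x\<close> is in the jump set.

  The absence of Zeno behaviour is the local finiteness of \<open>T\<close>.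
\<close>

definition trajectory ::
  "('n::finite, 'p::finite) reset_system \<Rightarrow> (real \<Rightarrow> real^'p) \<Rightarrow> (real \<Rightarrow> real^'n) \<Rightarrow> real set \<Rightarrow> bool" where
  "trajectory \<RR> u x T \<longleftrightarrow>
     T \<subseteq> {0..} \<and> (\<forall>t. finite (T \<inter> {0..t})) \<and>
     x 0 = 0 \<and>
     (\<forall>t\<in>{0..} - T. x t \<in> flow_set \<RR>) \<and>
     (\<forall>a b. 0 \<le> a \<and> a < b \<and> {a..<b} \<inter> T = {} \<longrightarrow>
        (\<lambda>s. matA \<RR> *v x s + matB \<RR> *v u s) absolutely_integrable_on {a..b} \<and>
        x b - x a = integral {a..b} (\<lambda>s. matA \<RR> *v x s + matB \<RR> *v u s)) \<and>
     (\<forall>t\<in>T. x t \<in> closure (jump_set \<RR>) \<and> (x \<longlongrightarrow> matR \<RR> *v x t) (at_right t))"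

definition outputs :: "('n::finite, 'p::finite) reset_system \<Rightarrow> (real \<Rightarrow> real^'p) \<Rightarrow> (real \<Rightarrow> real^'p) set" where
  "outputs \<RR> u =
     {y. \<exists>x T. trajectory \<RR> u x T \<and> (\<forall>t\<ge>0. y t = matC \<RR> *v x t + matD \<RR> *v u t)}"

definition L2_stable :: "('n::finite, 'p::finite) reset_system \<Rightarrow> bool" where
  "L2_stable \<RR> \<longleftrightarrow>
     (\<forall>u\<in>L2. \<forall>x T. trajectory \<RR> u x T \<longrightarrow>
        x \<in> L2 \<and> (\<lambda>t. matC \<RR> *v x t + matD \<RR> *v u t) \<in> L2 \<and> (x \<longlongrightarrow> 0) at_top)"


definition gain :: "(real \<Rightarrow> real^'p) \<Rightarrow> (real \<Rightarrow> real^'p) \<Rightarrow> real" where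
  "gain u y = L2_norm y / L2_norm u"

definition phase :: "(real \<Rightarrow> real^'p) \<Rightarrow> (real \<Rightarrow> real^'p) \<Rightarrow> real" where
  "phase u y =
     (if L2_zero y then 0 else arccos (L2_inner u y / (L2_norm u * L2_norm y)))"

definition z_set :: "(real \<Rightarrow> real^'p) \<Rightarrow> ('n::finite, 'p::finite) reset_system \<Rightarrow> complex set" where
  "z_set u \<RR> =
     (\<Union>y\<in>outputs \<RR> u. {complex_of_real (gain u y) * exp (\<i> * complex_of_real (phase u y)),
                       complex_of_real (gain u y) * exp (- \<i> * complex_of_real (phase u y))})"

definition samples :: "('n::finite, 'p::finite) reset_system \<Rightarrow> (real \<Rightarrow> real^'p) set \<Rightarrow> complex set" where
  "samples \<RR> U = (\<Union>u\<in>U. z_set u \<RR>)"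


definition kronecker :: "real^'a^'b \<Rightarrow> real^'c^'d \<Rightarrow> real^('a \<times> 'c)^('b \<times> 'd)" where
  "kronecker P Q = (\<chi> i j. P $ fst i $ fst j * Q $ snd i $ snd j)"

text \<open>The block vector with upper block \<open>y\<close> and lower block \<open>u\<close>.\<close>

definition stack :: "real^'p \<Rightarrow> real^'p \<Rightarrow> real^(2 \<times> 'p)" where
  "stack y u = (\<chi> i. if fst i = 1 then y $ snd i else u $ snd i)"

definition dissipativity_set :: "('n::finite, 'p::finite) reset_system \<Rightarrow> (real^2^2) set" where
  "dissipativity_set \<RR> =
     {P. transpose P = P \<and>
         (\<forall>u\<in>L2. \<forall>y\<in>outputs \<RR> u.
            (\<integral>t. stack (y t) (u t) \<bullet> (kronecker P (mat 1 :: real^'p^'p) *v stack (y t) (u t))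
               \<partial>lebesgue_on {0..}) \<ge> 0)}"

text \<open>For symmetric \<open>P\<close> the Hermitian form is real-valued, so that membership in the non-negative
  reals only asks for its sign.\<close>

definition S_region :: "real^2^2 \<Rightarrow> complex set" where
  "S_region P =
     {z. (let v = (vector [z, 1] :: complex^2) in
           (\<Sum>i\<in>UNIV. \<Sum>j\<in>UNIV. cnj (v $ i) * complex_of_real (P $ i $ j) * v $ j)) \<in> \<real>\<^sub>\<ge>\<^sub>0}"


definition upper_half :: "complex set" where
  "upper_half = {z. Im z \<ge> 0}"

text \<open>The upper half of a circle centred on the real axis is a graph over the real part, so its
  section with endpoints \<open>z1\<close>, \<open>z2\<close> consists of the points with real part between \<open>Re z1\<close>
  and \<open>Re z2\<close>.\<close>

definition arc_min :: "complex \<Rightarrow> complex \<Rightarrow> complex set" where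
  "arc_min z1 z2 =
     (if Re z1 = Re z2 then closed_segment z1 z2
      else {z \<in> upper_half. Re z \<in> closed_segment (Re z1) (Re z2) \<and>
              (\<exists>c r::real. {z1, z2, z} \<subseteq> sphere (complex_of_real c) r)})"

definition h_convex :: "complex set \<Rightarrow> bool" where
  "h_convex S \<longleftrightarrow> S \<subseteq> upper_half \<and> (\<forall>z1\<in>S. \<forall>z2\<in>S. arc_min z1 z2 \<subseteq> S)"

text \<open>For sets symmetric about the real axis.  Here \<open>h_convex hull X\<close> is the intersection of all
  h-convex supersets of \<open>X\<close>.\<close>

definition h_hull :: "complex set \<Rightarrow> complex set" where
  "h_hull X = (h_convex hull (X \<inter> upper_half)) \<union> cnj ` (h_convex hull (X \<inter> upper_half))"

end

theory Submission
  imports Defs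
begin

text \<open>
  Write \<open>a = P\<^sub>1\<^sub>1\<close>, \<open>b = P\<^sub>1\<^sub>2 = P\<^sub>2\<^sub>1\<close>, \<open>c = P\<^sub>2\<^sub>2\<close>.  The region of \<open>P\<close> is cut out by the inequality
  \<open>a |z|\<^sup>2 + 2 b Re z + c \<ge> 0\<close>, and the theorem combines two observations about it.

  A sample \<open>z\<close> of an input-output pair \<open>(u, y)\<close> carries exactly the second moments of the pair:
  \<open>|z|\<^sup>2 = \<parallel>y\<parallel>\<^sup>2 / \<parallel>u\<parallel>\<^sup>2\<close> and, by Cauchy-Schwarz, \<open>Re z = \<langle>u, y\<rangle> / \<parallel>u\<parallel>\<^sup>2\<close>.  Hence
  the inequality for \<open>z\<close> is the dissipation inequality divided by \<open>\<parallel>u\<parallel>\<^sup>2\<close>, so every sample lies in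
  the region (\<open>samples_subset_S_region\<close>).

  The upper half of the region is h-convex (\<open>h_convex_S_region\<close>).  On a circle centred on the real
  axis \<open>|z|\<^sup>2\<close> is an affine function of \<open>Re z\<close>, so along a geodesic the left-hand side is affine in
  \<open>Re z\<close> and stays non-negative between two end points where it is non-negative.

  The region is moreover symmetric about the real axis, so it contains the whole hull of any subset.
\<close>

section \<open>Geometry of the region of a quadratic form\<close>

lemma transpose_eq_self_nth:
  assumes "transpose P = P"
  shows "P$i$j = P$j$i"
proof -
  have "P$i$j = transpose P$i$j"
    by (simp only: assms)
  then show ?thesis
    by (simp add: transpose_def)
qed

lemma S_region_iff:
  assumes "transpose P = P"
  shows "z \<in> S_region P \<longleftrightarrow> P$1$1 * (cmod z)\<^sup>2 + 2 * P$1$2 * Re z + P$2$2 \<ge> 0"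
proof -
  have sym: "P$2$1 = P$1$2"
    by (rule transpose_eq_self_nth[OF assms])
  define w where "w = cnj z * of_real (P$1$1) * z + cnj z * of_real (P$1$2)
                      + of_real (P$1$2) * z + of_real (P$2$2)"
  have w: "w = of_real (P$1$1 * (cmod z)\<^sup>2 + 2 * P$1$2 * Re z + P$2$2)"
    unfolding w_def cmod_power2 by (simp add: complex_eq_iff power2_eq_square algebra_simps)
  have "z \<in> S_region P \<longleftrightarrow> w \<in> \<real>\<^sub>\<ge>\<^sub>0"
    by (simp add: S_region_def sum_2 sym w_def add.assoc)
  then show ?thesis
    by (simp only: w nonneg_Reals_of_real_iff)
qed

lemma cnj_in_S_region_iff:
  assumes "transpose P = P"
  shows "cnj z \<in> S_region P \<longleftrightarrow> z \<in> S_region P"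
  by (simp add: S_region_iff[OF assms])

lemma affine_nonneg_between:
  fixes m k x1 x2 x :: real
  assumes "m * x1 + k \<ge> 0" "m * x2 + k \<ge> 0" "x \<in> closed_segment x1 x2"
  shows "m * x + k \<ge> 0"
proof -
  have "{x. m * x + k \<ge> 0} = {x. m \<bullet> x \<ge> - k}"
    by auto
  then have "convex {x. m * x + k \<ge> 0}"
    by (simp only: convex_halfspace_ge)
  then show ?thesis
    using assms closed_segment_subset[of x1 "{x. m * x + k \<ge> 0}" x2] by auto
qed

text \<open>The centre is real, so the imaginary part enters the equation of the circle only through
  \<open>|z|\<^sup>2\<close>.\<close>

lemma sphere_real_centre_cmod_power2:
  assumes "z \<in> sphere (complex_of_real c) r"
  shows "(cmod z)\<^sup>2 = 2 * c * Re z + (r\<^sup>2 - c\<^sup>2)"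
proof -
  have "r = cmod (z - of_real c)"
    using assms by (simp add: dist_norm norm_minus_commute)
  then have "r\<^sup>2 = (Re z - c)\<^sup>2 + (Im z)\<^sup>2"
    by (simp add: cmod_power2)
  then show ?thesis
    unfolding cmod_power2 by (simp add: power2_eq_square algebra_simps)
qed

text \<open>The form is affine along a geodesic in a suitable coordinate: the real part on a circular arc,
  and the square of the imaginary part on a vertical segment, where that square is monotone because
  the imaginary part does not change sign.\<close>

lemma arc_min_subset_S_region:
  assumes P: "transpose P = P"
    and z1: "z1 \<in> S_region P \<inter> upper_half" and z2: "z2 \<in> S_region P \<inter> upper_half"
  shows "arc_min z1 z2 \<subseteq> S_region P \<inter> upper_half"
proof
  fix z assume z: "z \<in> arc_min z1 z2"
  let ?q = "\<lambda>z. P$1$1 * (cmod z)\<^sup>2 + 2 * P$1$2 * Re z + P$2$2"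
  have q: "?q z1 \<ge> 0" "?q z2 \<ge> 0"
    using z1 z2 S_region_iff[OF P] by auto
  have im: "Im z1 \<ge> 0" "Im z2 \<ge> 0"
    using z1 z2 by (auto simp: upper_half_def)
  show "z \<in> S_region P \<inter> upper_half"
  proof (cases "Re z1 = Re z2")
    case True
    then have seg: "z \<in> closed_segment z1 z2"
      using z by (simp add: arc_min_def)
    then obtain s where s: "0 \<le> s" "s \<le> 1" "z = (1 - s) *\<^sub>R z1 + s *\<^sub>R z2"
      by (auto simp: in_segment)
    have re: "Re z = Re z1"
      unfolding s(3) using True by (simp add: algebra_simps)
    have imz: "Im z \<in> closed_segment (Im z1) (Im z2)"
      using s by (auto simp: in_segment)
    then have sq: "(Im z)\<^sup>2 \<in> closed_segment ((Im z1)\<^sup>2) ((Im z2)\<^sup>2)" and pos: "Im z \<ge> 0"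
      using im by (auto simp: closed_segment_eq_real_ivl power_mono split: if_splits)
    let ?k = "P$1$1 * (Re z1)\<^sup>2 + 2 * P$1$2 * Re z1 + P$2$2"
    have "P$1$1 * (Im z)\<^sup>2 + ?k \<ge> 0"
      using q True by (intro affine_nonneg_between[OF _ _ sq]) (simp_all add: cmod_power2 algebra_simps)
    then have "?q z \<ge> 0"
      by (simp add: cmod_power2 re algebra_simps)
    then show ?thesis
      using pos by (simp add: S_region_iff[OF P] upper_half_def)
  next
    case False
    then obtain c r where up: "z \<in> upper_half" and seg: "Re z \<in> closed_segment (Re z1) (Re z2)"
      and on: "z1 \<in> sphere (complex_of_real c) r" "z2 \<in> sphere (complex_of_real c) r"
              "z \<in> sphere (complex_of_real c) r"
      using z by (auto simp: arc_min_def)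
    let ?m = "2 * P$1$1 * c + 2 * P$1$2" and ?k = "P$1$1 * (r\<^sup>2 - c\<^sup>2) + P$2$2"
    have aff: "?q v = ?m * Re v + ?k" if "v \<in> sphere (complex_of_real c) r" for v
      unfolding sphere_real_centre_cmod_power2[OF that] by (simp add: algebra_simps)
    have "?m * Re z + ?k \<ge> 0"
      using q unfolding aff[OF on(1)] aff[OF on(2)] by (rule affine_nonneg_between[OF _ _ seg])
    then have "?q z \<ge> 0"
      unfolding aff[OF on(3)] .
    then show ?thesis
      using up by (simp add: S_region_iff[OF P])
  qed
qed

lemma h_convex_S_region:
  assumes "transpose P = P"
  shows "h_convex (S_region P \<inter> upper_half)"
  using arc_min_subset_S_region[OF assms] by (simp add: h_convex_def)

lemma h_hull_subset_S_region:
  assumes P: "transpose P = P" and X: "X \<subseteq> S_region P"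
  shows "h_hull X \<subseteq> S_region P"
proof -
  have "h_convex hull (X \<inter> upper_half) \<subseteq> S_region P \<inter> upper_half"
    using X by (intro hull_minimal h_convex_S_region[OF P]) auto
  then show ?thesis
    by (auto simp: h_hull_def cnj_in_S_region_iff[OF P])
qed

section \<open>Square-integrable signals\<close>

text \<open>The product is dominated by \<open>|u|\<^sup>2 + |y|\<^sup>2\<close>.\<close>

lemma L2_inner_integrable:
  assumes "u \<in> L2" "y \<in> L2"
  shows "integrable (lebesgue_on {0..}) (\<lambda>t. u t \<bullet> y t)"
proof (rule Bochner_Integration.integrable_bound)
  show "integrable (lebesgue_on {0..}) (\<lambda>t. u t \<bullet> u t + y t \<bullet> y t)"
    using assms by (simp add: L2_def)
  show "(\<lambda>t. u t \<bullet> y t) \<in> borel_measurable (lebesgue_on {0..})"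
    using assms by (simp add: L2_def borel_measurable_inner)
  have "\<bar>v \<bullet> w\<bar> \<le> v \<bullet> v + w \<bullet> w" for v w :: "real^'a"
  proof -
    have "(v + w) \<bullet> (v + w) \<ge> 0" "(v - w) \<bullet> (v - w) \<ge> 0" "v \<bullet> v \<ge> 0" "w \<bullet> w \<ge> 0"
      by simp_all
    then show ?thesis
      by (simp add: inner_add_left inner_add_right inner_diff_left inner_diff_right inner_commute)
  qed
  then show "AE t in lebesgue_on {0..}. norm (u t \<bullet> y t) \<le> norm (u t \<bullet> u t + y t \<bullet> y t)"
    by simp
qed

lemma L2_inner_nonneg: "L2_inner u u \<ge> 0"
  by (simp add: L2_inner_def)

lemma L2_norm_power2: "(L2_norm u)\<^sup>2 = L2_inner u u"
  by (simp add: L2_norm_def L2_inner_nonneg)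

lemma L2_inner_self_eq_0_iff:
  assumes "u \<in> L2"
  shows "L2_inner u u = 0 \<longleftrightarrow> L2_zero u"
  using assms by (simp add: L2_inner_def L2_zero_def L2_def integral_nonneg_eq_0_iff_AE)

lemma L2_norm_pos:
  assumes "u \<in> L2" "\<not> L2_zero u"
  shows "L2_norm u > 0"
  using assms L2_inner_nonneg[of u] L2_inner_self_eq_0_iff[of u] by (simp add: L2_norm_def)

lemma L2_inner_zero_right:
  assumes "L2_zero y"
  shows "L2_inner u y = 0"
  unfolding L2_inner_def
  by (rule integral_eq_zero_AE) (use assms in \<open>auto simp: L2_zero_def\<close>)

lemma L2_quadratic_form_integral:
  assumes "u \<in> L2" "y \<in> L2"
  shows "(\<integral>t. a * (y t \<bullet> y t) + b * (u t \<bullet> y t) + c * (u t \<bullet> u t) \<partial>lebesgue_on {0..})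
         = a * L2_inner y y + b * L2_inner u y + c * L2_inner u u"
  using L2_inner_integrable[OF assms] L2_inner_integrable[OF assms(1,1)]
    L2_inner_integrable[OF assms(2,2)]
  by (simp add: L2_inner_def)

lemma L2_Cauchy_Schwarz:
  assumes u: "u \<in> L2" and y: "y \<in> L2"
  shows "\<bar>L2_inner u y\<bar> \<le> L2_norm u * L2_norm y"
proof (cases "L2_zero y")
  case True
  then show ?thesis
    using L2_inner_nonneg by (simp add: L2_inner_zero_right L2_norm_def)
next
  case False
  define n where "n = L2_inner y y"
  define i where "i = L2_inner u y"
  have n: "n > 0"
    using L2_inner_nonneg[of y] L2_inner_self_eq_0_iff[OF y] False by (simp add: n_def)
  \<comment> \<open>Multiplied by \<open>1/n\<close>, the vector \<open>n u - i y\<close> is the component of \<open>u\<close> orthogonal to \<open>y\<close>;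
    non-negativity of its squared norm is the inequality.\<close>
  have "0 \<le> (\<integral>t. (n *\<^sub>R u t - i *\<^sub>R y t) \<bullet> (n *\<^sub>R u t - i *\<^sub>R y t) \<partial>lebesgue_on {0..})"
    by simp
  also have "\<dots> = (\<integral>t. i\<^sup>2 * (y t \<bullet> y t) + (- 2 * n * i) * (u t \<bullet> y t) + n\<^sup>2 * (u t \<bullet> u t)
                    \<partial>lebesgue_on {0..})"
    by (rule arg_cong[where f = "integral\<^sup>L _"])
      (auto simp: fun_eq_iff inner_diff_left inner_diff_right inner_commute power2_eq_square
        algebra_simps)
  also have "\<dots> = n * (n * L2_inner u u - i\<^sup>2)"
    unfolding L2_quadratic_form_integral[OF u y]
    by (simp add: n_def i_def power2_eq_square algebra_simps)
  finally have "i\<^sup>2 \<le> L2_inner u u * n"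
    using n by (simp add: zero_le_mult_iff mult.commute)
  then have "sqrt (i\<^sup>2) \<le> sqrt (L2_inner u u * n)"
    by (rule real_sqrt_le_mono)
  then show ?thesis
    by (simp add: i_def n_def L2_norm_def real_sqrt_mult)
qed

text \<open>Cauchy-Schwarz keeps the argument of the arccosine in \<open>[-1, 1]\<close>, where the cosine inverts it.\<close>

lemma gain_cos_phase:
  assumes u: "u \<in> L2" "\<not> L2_zero u" and y: "y \<in> L2"
  shows "gain u y * cos (phase u y) = L2_inner u y / L2_inner u u"
proof (cases "L2_zero y")
  case True
  then have "L2_norm y = 0"
    using L2_inner_self_eq_0_iff[OF y] by (simp add: L2_norm_def)
  then show ?thesis
    using True by (simp add: gain_def L2_inner_zero_right)
next
  case False
  have nu: "L2_norm u > 0" and ny: "L2_norm y > 0"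
    using L2_norm_pos u y False by blast+
  have "\<bar>L2_inner u y / (L2_norm u * L2_norm y)\<bar> \<le> 1"
    using L2_Cauchy_Schwarz[OF u(1) y] nu ny by (simp add: abs_mult)
  then have "cos (phase u y) = L2_inner u y / (L2_norm u * L2_norm y)"
    using False by (simp add: phase_def cos_arccos_abs)
  then show ?thesis
    using nu ny by (simp add: gain_def L2_norm_power2[symmetric] power2_eq_square)
qed

section \<open>Samples of a dissipative reset system\<close>

lemma kronecker_quadratic_form:
  assumes "transpose P = P"
  shows "stack y u \<bullet> (kronecker P (mat 1) *v stack y u)
         = P$1$1 * (y \<bullet> y) + 2 * P$1$2 * (u \<bullet> y) + P$2$2 * (u \<bullet> u)"
proof -
  have sym: "P$2$1 = P$1$2"
    by (rule transpose_eq_self_nth[OF assms])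
  have split: "(\<Sum>i\<in>UNIV. f i) = (\<Sum>k\<in>UNIV. f (1, k)) + (\<Sum>k\<in>UNIV. f (2, k))"
    for f :: "2 \<times> 'a \<Rightarrow> real"
  proof -
    have "sum f UNIV = sum f (UNIV \<times> UNIV)"
      by (simp only: UNIV_Times_UNIV)
    also have "\<dots> = (\<Sum>i\<in>UNIV. \<Sum>k\<in>UNIV. f (i, k))"
      by (rule sum.cartesian_product')
    finally show ?thesis
      by (simp only: sum_2)
  qed
  have delta: "(\<Sum>j\<in>UNIV. c * mat 1$k$j * v$j) = c * v$k" for c k and v :: "real^'a"
  proof -
    have "(\<Sum>j\<in>UNIV. c * mat 1$k$j * v$j) = c * (mat 1 *v v)$k"
      by (simp add: matrix_vector_mult_def sum_distrib_left mult.assoc)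
    then show ?thesis
      by simp
  qed
  have row: "(kronecker P (mat 1) *v stack y u)$(i, k) = P$i$1 * y$k + P$i$2 * u$k" for i k
  proof -
    have "(kronecker P (mat 1) *v stack y u)$(i, k)
          = (\<Sum>j\<in>UNIV. P$i$1 * mat 1$k$j * y$j) + (\<Sum>j\<in>UNIV. P$i$2 * mat 1$k$j * u$j)"
      by (simp add: matrix_vector_mult_def split kronecker_def stack_def)
    then show ?thesis
      by (simp only: delta)
  qed
  have "stack y u \<bullet> (kronecker P (mat 1) *v stack y u)
        = (\<Sum>k\<in>UNIV. y$k * (P$1$1 * y$k + P$1$2 * u$k))
          + (\<Sum>k\<in>UNIV. u$k * (P$1$2 * y$k + P$2$2 * u$k))"
    unfolding inner_vec_def split row by (simp add: stack_def sym)
  also have "\<dots> = (\<Sum>k\<in>UNIV. P$1$1 * (y$k * y$k) + 2 * P$1$2 * (u$k * y$k) + P$2$2 * (u$k * u$k))"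
    unfolding sum.distrib[symmetric] by (rule sum.cong) (simp_all add: algebra_simps)
  also have "\<dots> = P$1$1 * (y \<bullet> y) + 2 * P$1$2 * (u \<bullet> y) + P$2$2 * (u \<bullet> u)"
    by (simp add: inner_vec_def sum.distrib sum_distrib_left)
  finally show ?thesis .
qed

text \<open>An output is only pinned down at non-negative times, so it need not be the very function that
  stability speaks about, but square-integrability does not see the difference.\<close>

lemma outputs_subset_L2:
  assumes "L2_stable \<RR>" "u \<in> L2"
  shows "outputs \<RR> u \<subseteq> L2"
proof
  fix y assume "y \<in> outputs \<RR> u"
  then obtain x T where "trajectory \<RR> u x T"
    and eq: "\<And>t. t \<ge> 0 \<Longrightarrow> y t = matC \<RR> *v x t + matD \<RR> *v u t"
    by (auto simp: outputs_def)
  then have g: "(\<lambda>t. matC \<RR> *v x t + matD \<RR> *v u t) \<in> L2"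
    using assms by (auto simp: L2_stable_def)
  have "y \<in> borel_measurable (lebesgue_on {0..}) \<longleftrightarrow>
        (\<lambda>t. matC \<RR> *v x t + matD \<RR> *v u t) \<in> borel_measurable (lebesgue_on {0..})"
    by (rule measurable_cong) (simp add: eq)
  moreover have "integrable (lebesgue_on {0..}) (\<lambda>t. y t \<bullet> y t) \<longleftrightarrow>
        integrable (lebesgue_on {0..}) (\<lambda>t. (matC \<RR> *v x t + matD \<RR> *v u t)
                                          \<bullet> (matC \<RR> *v x t + matD \<RR> *v u t))"
    by (rule Bochner_Integration.integrable_cong) (simp_all add: eq)
  ultimately show "y \<in> L2"
    using g by (simp add: L2_def)
qed

text \<open>The defining inequality of the region at a sample is the dissipation inequality divided by
  \<open>\<parallel>u\<parallel>\<^sup>2\<close>.\<close>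

lemma samples_subset_S_region:
  assumes stable: "L2_stable \<RR>" and P: "P \<in> dissipativity_set \<RR>" and U: "U \<subseteq> L2_nonzero"
  shows "samples \<RR> U \<subseteq> S_region P"
proof
  fix z assume "z \<in> samples \<RR> U"
  then obtain u y where "u \<in> U" and out: "y \<in> outputs \<RR> u"
    and z: "z = of_real (gain u y) * exp (\<i> * of_real (phase u y)) \<or>
            z = of_real (gain u y) * exp (- \<i> * of_real (phase u y))"
    by (auto simp: samples_def z_set_def)
  then have u: "u \<in> L2" "\<not> L2_zero u"
    using U by (auto simp: L2_nonzero_def)
  have y: "y \<in> L2"
    using outputs_subset_L2[OF stable u(1)] out by auto
  have sym: "transpose P = P"
    using P by (simp add: dissipativity_set_def)
  have "0 \<le> (\<integral>t. stack (y t) (u t) \<bullet> (kronecker P (mat 1) *v stack (y t) (u t))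
              \<partial>lebesgue_on {0..})"
    using P u(1) out by (simp add: dissipativity_set_def)
  then have diss: "0 \<le> P$1$1 * L2_inner y y + 2 * P$1$2 * L2_inner u y + P$2$2 * L2_inner u u"
    by (simp only: kronecker_quadratic_form[OF sym] L2_quadratic_form_integral[OF u(1) y])
  have n: "L2_inner u u > 0"
    using L2_norm_pos[OF u] by (simp add: L2_norm_def)
  have "cmod z = \<bar>gain u y\<bar>"
    using z by (auto simp: norm_mult norm_exp_eq_Re)
  then have mod: "(cmod z)\<^sup>2 = L2_inner y y / L2_inner u u"
    by (simp add: gain_def power_divide L2_norm_power2)
  have "Re z = gain u y * cos (phase u y)"
    using z by (auto simp: Re_exp)
  then have re: "Re z = L2_inner u y / L2_inner u u"
    using gain_cos_phase[OF u y] by simp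
  have "P$1$1 * (cmod z)\<^sup>2 + 2 * P$1$2 * Re z + P$2$2
        = (P$1$1 * L2_inner y y + 2 * P$1$2 * L2_inner u y + P$2$2 * L2_inner u u) / L2_inner u u"
    using n by (simp add: mod re field_simps)
  also have "\<dots> \<ge> 0"
    using diss n by simp
  finally show "z \<in> S_region P"
    by (simp add: S_region_iff[OF sym])
qed

theorem theorem2:
  fixes \<RR> :: "('n::finite, 'p::finite) reset_system"
    and Pis :: "(real^2^2) set"
    and U :: "(real \<Rightarrow> real^'p) set"
  assumes "transpose (matM \<RR>) = matM \<RR>"
    and "L2_stable \<RR>"
    and "Pis \<subseteq> dissipativity_set \<RR>"
    and "U \<subseteq> L2_nonzero"
  shows "h_hull (samples \<RR> U) \<subseteq> (\<Inter>P\<in>Pis. S_region P)"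
proof (rule INT_greatest)
  fix P assume "P \<in> Pis"
  then have P: "P \<in> dissipativity_set \<RR>"
    using assms(3) by auto
  then have "transpose P = P"
    by (simp add: dissipativity_set_def)
  then show "h_hull (samples \<RR> U) \<subseteq> S_region P"
    by (rule h_hull_subset_S_region[OF _ samples_subset_S_region[OF assms(2) P assms(4)]])
qed

end
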